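(* Let $m,n\ge 1$, let $U=\{u_1,\dots,u_m\}$ be a set of Boolean variables and $C=\{c_1,\dots,c_n\}$ a collection of $3$-literal clauses over $U$. Let $y\in\mathbb{R}^{6mn}$ be the objective vector associated with this instance as follows (superscripts $k+1$, $k+2$ taken modulo $3$ with representatives in $\{1,2,3\}$): if clause $c_j$ has the literal $u_i$ at place $k$, then $y^{k,1}_{i,j}=y^{k+1,2}_{i,j}=y^{k+2,1}_{i,j}=y^{k+2,2}_{i,j}=1$; if clause $c_j$ has the literal $\overline{u}_i$ at place $k$, then $y^{k,2}_{i,j}=y^{k+1,1}_{i,j}=y^{k+2,1}_{i,j}=y^{k+2,2}_{i,j}=1$; all remaining coordinates of $y$ equal $0$. Let $f_y(x)=\langle y,x\rangle$. Then there exists a truth assignment to $U$ such that each clause of $C$ has at least one true literal and at least one false literal if and only if $$\max_{x\in SATP_{LP}(m,n)} f_y(x)=\max_{z\in SATP(m,n)} f_y(z)=3n.$$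
   Context: For positive integers $m,n$, points of $\mathbb{R}^{6mn}$ have coordinates $x^{k,l}_{i,j}$ with $k\in\{1,2,3\}$, $l\in\{1,2\}$, $i\in\{1,\dots,m\}$, $j\in\{1,\dots,n\}$. $SATP_{LP}(m,n)\subset\mathbb{R}^{6mn}$ is the polytope of all solutions of the system $$\sum_{k,l}x^{k,l}_{i,j}=1,\qquad x^{1,1}_{i,j}+x^{2,1}_{i,j}+x^{3,1}_{i,j}=x^{1,1}_{i,t}+x^{2,1}_{i,t}+x^{3,1}_{i,t},\qquad x^{k,1}_{i,j}+x^{k,2}_{i,j}=x^{k,1}_{s,j}+x^{k,2}_{s,j},\qquad x^{k,l}_{i,j}\ge 0,$$ for all $k\in\{1,2,3\}$, $l\in\{1,2\}$, $i,s\in\{1,\dots,m\}$, $j,t\in\{1,\dots,n\}$, and $SATP(m,n)$ is the convex hull of all integral solutions of this system. A 3-literal clause has three literals occupying places $1,2,3$, each being a variable $u_i$ or its negation $\overline{u}_i$; the three literals of a clause involve three distinct variables. *)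

theory Defs
  imports "HOL-Analysis.Analysis"
begin

text \<open>
  Points of $R^{6mn}$: the coordinate $x^{k,l}_{i,j}$ is \<open>x $ i $ j $ k $ l\<close>, where \<open>m\<close> and \<open>n\<close> are
  the cardinalities of the index types \<open>'m\<close> and \<open>'n\<close>. The places are the elements \<open>1, 2, 3\<close> of the
  three-element type \<open>3\<close>, and \<open>l\<close> ranges over the elements \<open>1, 2\<close> of the two-element type \<open>2\<close>.
  Arithmetic in these types is modular (\<open>3 = 0\<close> and \<open>2 = 0\<close>, respectively), so \<open>k + 1\<close> and \<open>k + 2\<close>
  for \<open>k :: 3\<close> are taken modulo 3.
\<close>

type_synonym ('m, 'n) satp_space = "real ^ 2 ^ 3 ^ 'n ^ 'm"

lemma DIM_satp_space:
  "DIM(('m::finite, 'n::finite) satp_space) = 6 * CARD('m) * CARD('n)"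
  by simp

definition SATP_LP :: "('m::finite, 'n::finite) satp_space set" where
  "SATP_LP = {x.
     (\<forall>i j. (\<Sum>k\<in>UNIV. \<Sum>l\<in>UNIV. x $ i $ j $ k $ l) = 1) \<and>
     (\<forall>i j t. x $ i $ j $ 1 $ 1 + x $ i $ j $ 2 $ 1 + x $ i $ j $ 3 $ 1
            = x $ i $ t $ 1 $ 1 + x $ i $ t $ 2 $ 1 + x $ i $ t $ 3 $ 1) \<and>
     (\<forall>i s j k. x $ i $ j $ k $ 1 + x $ i $ j $ k $ 2
              = x $ s $ j $ k $ 1 + x $ s $ j $ k $ 2) \<and>
     (\<forall>i j k l. x $ i $ j $ k $ l \<ge> 0)}"

definition SATP :: "('m::finite, 'n::finite) satp_space set" where
  "SATP = convex hull {x \<in> SATP_LP. \<forall>i j k l. x $ i $ j $ k $ l \<in> \<int>}"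

datatype 'v literal = Pos (lit_var: 'v) | Neg (lit_var: 'v)

fun lit_true :: "('v \<Rightarrow> bool) \<Rightarrow> 'v literal \<Rightarrow> bool" where
  "lit_true \<tau> (Pos u) = \<tau> u"
| "lit_true \<tau> (Neg u) = (\<not> \<tau> u)"

type_synonym 'v clause3 = "3 \<Rightarrow> 'v literal"

definition distinct_vars :: "'v clause3 \<Rightarrow> bool" where
  "distinct_vars c \<longleftrightarrow> inj (\<lambda>k. lit_var (c k))"

definition objective :: "('n \<Rightarrow> 'm clause3) \<Rightarrow> ('m::finite, 'n::finite) satp_space" where
  "objective c = (\<chi> i j k' l.
     if \<exists>k. c j k = Pos i \<and> (k', l) \<in> {(k, 1), (k + 1, 2), (k + 2, 1), (k + 2, 2)} \<or>
            c j k = Neg i \<and> (k', l) \<in> {(k, 2), (k + 1, 1), (k + 2, 1), (k + 2, 2)}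
     then 1 else 0)"

text \<open>
  The maximum of a real function over an arbitrary, possibly infinite, set. It is a relation
  because \<open>Max\<close> is only meaningful for finite sets and \<open>Sup\<close> does not assert attainment.
\<close>

definition is_max_over :: "('a \<Rightarrow> real) \<Rightarrow> 'a set \<Rightarrow> real \<Rightarrow> bool" where
  "is_max_over f S v \<longleftrightarrow> (\<exists>x\<in>S. f x = v) \<and> (\<forall>x\<in>S. f x \<le> v)"

end

theory Submission
  imports Defs
begin

text \<open>
  An integral point of \<open>SATP_LP\<close> amounts to a truth assignment \<open>\<tau>\<close> together with a choice of a place
  \<open>\<kappa> j\<close> for every clause \<open>j\<close>. For such a point clause \<open>j\<close> contributes 3, minus 1 if its literal at
  place \<open>\<kappa> j\<close> is false, minus 1 if its literal at the preceding place \<open>\<kappa> j + 2\<close> is true. A clause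
  has both a true and a false literal iff, going cyclically through its places, a false literal is
  directly followed by a true one, that is, iff some choice of \<open>\<kappa> j\<close> makes the contribution 3. Since
  each of the three variables of a clause contributes at most 1 at any point of \<open>SATP_LP\<close>, the value
  never exceeds \<open>3 n\<close>.
\<close>

definition satp_vertex :: "('m \<Rightarrow> bool) \<Rightarrow> ('n \<Rightarrow> 3) \<Rightarrow> ('m::finite, 'n::finite) satp_space" where
  "satp_vertex \<tau> \<kappa> = (\<chi> i j k l. if k = \<kappa> j \<and> l = (if \<tau> i then 1 else 2) then 1 else 0)"

lemma exists_3: "(\<exists>k::3. P k) \<longleftrightarrow> P 1 \<or> P 2 \<or> P 3"
  by (metis exhaust_3)

text \<open>These are the values of \<open>k + 2\<close> at \<open>k = 2\<close> and
  \<open>k = 3\<close>, reduced to the representatives that the case distinctions over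
  \<open>1, 2, 3\<close> produce.\<close>

lemma numerals_mod_3: "(4::3) = 1" "(5::3) = 2"
  by simp_all

lemma satp_vertex_in_SATP_LP: "satp_vertex \<tau> \<kappa> \<in> SATP_LP"
proof -
  have place: "\<kappa> j = 1 \<or> \<kappa> j = 2 \<or> \<kappa> j = 3" for j
    by (rule exhaust_3)
  have "(\<Sum>k\<in>UNIV. \<Sum>l\<in>UNIV. satp_vertex \<tau> \<kappa> $ i $ j $ k $ l) = 1" for i j
    using place[of j] by (elim disjE) (simp_all add: satp_vertex_def sum_3 sum_2)
  moreover have "satp_vertex \<tau> \<kappa> $ i $ j $ 1 $ 1 + satp_vertex \<tau> \<kappa> $ i $ j $ 2 $ 1
      + satp_vertex \<tau> \<kappa> $ i $ j $ 3 $ 1 = of_bool (\<tau> i)" for i j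
    using place[of j] by (elim disjE) (simp_all add: satp_vertex_def)
  moreover have "satp_vertex \<tau> \<kappa> $ i $ j $ k $ 1 + satp_vertex \<tau> \<kappa> $ i $ j $ k $ 2
      = of_bool (k = \<kappa> j)" for i j k
    by (simp add: satp_vertex_def)
  moreover have "satp_vertex \<tau> \<kappa> $ i $ j $ k $ l \<ge> 0" for i j k l
    by (simp add: satp_vertex_def)
  ultimately show ?thesis
    unfolding SATP_LP_def by simp
qed

lemma satp_vertex_in_SATP: "satp_vertex \<tau> \<kappa> \<in> SATP"
  unfolding SATP_def
  by (rule hull_inc) (use satp_vertex_in_SATP_LP[of \<tau> \<kappa>] in \<open>auto simp: satp_vertex_def\<close>)

lemma nonneg_Ints_le_1_cases:
  fixes a :: real
  assumes "a \<in> \<int>" "0 \<le> a" "a \<le> 1"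
  shows "a = 0 \<or> a = 1"
  using assms by (elim Ints_cases) auto

text \<open>In the block of \<open>i\<close> and \<open>j\<close>, the mass in layer
  \<open>l = 1\<close> does not depend on \<open>j\<close>, and the mass at place \<open>k\<close>
  does not depend on \<open>i\<close>. Both are integers between 0 and 1, so the unit mass of the
  block sits in one coordinate: the layer gives \<open>\<tau> i\<close>, the place gives
  \<open>\<kappa> j\<close>.\<close>

lemma integral_SATP_LP_is_vertex:
  fixes x :: "('m::finite, 'n::finite) satp_space"
  assumes x: "x \<in> SATP_LP" and int: "\<And>i j k l. x $ i $ j $ k $ l \<in> \<int>"
  obtains \<tau> \<kappa> where "x = satp_vertex \<tau> \<kappa>"
proof -
  define a where "a i j = x $ i $ j $ 1 $ 1 + x $ i $ j $ 2 $ 1 + x $ i $ j $ 3 $ 1" for i j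
  define b where "b i j k = x $ i $ j $ k $ 1 + x $ i $ j $ k $ 2" for i j k
  have nonneg: "x $ i $ j $ k $ l \<ge> 0" for i j k l
    using x by (auto simp: SATP_LP_def)
  have block: "b i j 1 + b i j 2 + b i j 3 = 1" for i j
    using x by (auto simp: SATP_LP_def b_def sum_3 sum_2)
  have a_const: "a i j = a i t" for i j t
    using x by (simp add: SATP_LP_def a_def)
  have b_const: "b i j k = b s j k" for i s j k
    using x by (simp add: SATP_LP_def b_def)
  have a01: "a i j = 0 \<or> a i j = 1" for i j
  proof (rule nonneg_Ints_le_1_cases)
    show "a i j \<in> \<int>" by (auto simp: a_def int)
    show "0 \<le> a i j" by (simp add: a_def nonneg)
    show "a i j \<le> 1"
      using block[of i j] nonneg[of i j _ 2]
      unfolding a_def b_def by (smt (verit))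
  qed
  have b_nonneg: "b i j k \<ge> 0" for i j k
    by (simp add: b_def nonneg)
  have b01: "b i j k = 0 \<or> b i j k = 1" for i j k
  proof (rule nonneg_Ints_le_1_cases)
    show "b i j k \<in> \<int>" by (auto simp: b_def int)
    show "0 \<le> b i j k" by (rule b_nonneg)
    show "b i j k \<le> 1"
      using block[of i j] b_nonneg[of i j 1] b_nonneg[of i j 2] b_nonneg[of i j 3] exhaust_3[of k]
      by auto
  qed
  \<comment> \<open>Here \<open>undefined\<close> is just some clause index; by
    \<open>a_const\<close> any other gives the same value. Below it likewise stands for some
    variable index, by \<open>b_const\<close>.\<close>
  define \<tau> where "\<tau> i \<longleftrightarrow> a i undefined = 1" for i
  have "\<exists>k. \<forall>k'. b undefined j k' = (if k' = k then 1 else 0)" for j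
    using block[of undefined j] b01[of undefined j 1] b01[of undefined j 2] b01[of undefined j 3]
    by (auto simp: forall_3 exists_3)
  then obtain \<kappa> where \<kappa>: "\<And>j k'. b undefined j k' = (if k' = \<kappa> j then 1 else 0)"
    by metis
  have "x $ i $ j $ k $ l = satp_vertex \<tau> \<kappa> $ i $ j $ k $ l" for i j k l
  proof -
    \<comment> \<open>Two nonnegative entries with sum 0 both vanish, so \<open>a i j\<close>
      reduces to its single term at place \<open>\<kappa> j\<close>.\<close>
    have off: "x $ i $ j $ k' $ 1 = 0 \<and> x $ i $ j $ k' $ 2 = 0" if "k' \<noteq> \<kappa> j" for k'
      using b_const[of i j k' undefined] \<kappa>[of j k'] nonneg[of i j k' 1] nonneg[of i j k' 2] that
      by (simp add: b_def)
    have "x $ i $ j $ \<kappa> j $ 1 = a i j"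
      using exhaust_3[of "\<kappa> j"] off[of 1] off[of 2] off[of 3] unfolding a_def by auto
    moreover have "x $ i $ j $ \<kappa> j $ 1 + x $ i $ j $ \<kappa> j $ 2 = 1"
      using b_const[of i j "\<kappa> j" undefined] \<kappa>[of j "\<kappa> j"] by (simp add: b_def)
    ultimately show ?thesis
      using off[of k] exhaust_2[of l] a01[of i j] a_const[of i j undefined]
      by (cases "k = \<kappa> j") (auto simp: satp_vertex_def \<tau>_def)
  qed
  then have "x = satp_vertex \<tau> \<kappa>"
    by (simp add: vec_eq_iff)
  then show thesis by (rule that)
qed

text \<open>Distinctness of the variables means that no other literal of the clause affects this
  block. Of its six coefficients two are 0: at place \<open>p\<close> in the layer making the
  literal false, and at place \<open>p + 1\<close> in the layer making it true.\<close>

lemma objective_at_literal: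
  assumes "distinct_vars (c j)"
  shows "objective c $ lit_var (c j p) $ j $ k $ (if \<tau> (lit_var (c j p)) then 1 else 2) =
    (if k = p \<and> \<not> lit_true \<tau> (c j p) \<or> k = p + 1 \<and> lit_true \<tau> (c j p) then 0 else 1)"
proof -
  have uniq: "q = p" if "lit_var (c j q) = lit_var (c j p)" for q
    using assms that unfolding distinct_vars_def by (rule injD)
  have place: "k = p \<or> k = p + 1 \<or> k = p + 2"
    using exhaust_3[of p] exhaust_3[of k] by auto
  show ?thesis
  proof (cases "c j p")
    case (Pos u)
    have "c j q = Pos u \<longleftrightarrow> q = p" "c j q \<noteq> Neg u" for q
      using uniq[of q] Pos by auto
    then have "objective c $ u $ j $ k $ l =
        (if (k, l) \<in> {(p, 1), (p + 1, 2), (p + 2, 1), (p + 2, 2)} then 1 else 0)" for l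
      by (simp add: objective_def)
    then show ?thesis
      using place Pos by (elim disjE) simp_all
  next
    case (Neg u)
    have "c j q = Neg u \<longleftrightarrow> q = p" "c j q \<noteq> Pos u" for q
      using uniq[of q] Neg by auto
    then have "objective c $ u $ j $ k $ l =
        (if (k, l) \<in> {(p, 2), (p + 1, 1), (p + 2, 1), (p + 2, 2)} then 1 else 0)" for l
      by (simp add: objective_def)
    then show ?thesis
      using place Neg by (elim disjE) simp_all
  qed
qed

text \<open>The objective vanishes on the block of a variable that does not occur in the clause. The
  remaining variables correspond one-to-one to the three places, by
  \<open>distinct_vars\<close>.\<close>

lemma inner_objective:
  fixes c :: "'n::finite \<Rightarrow> 'm::finite clause3"
  assumes "\<And>j. distinct_vars (c j)"
  shows "inner (objective c) x = (\<Sum>j\<in>UNIV. \<Sum>p\<in>UNIV. \<Sum>k\<in>UNIV. \<Sum>l\<in>UNIV.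
    objective c $ lit_var (c j p) $ j $ k $ l * x $ lit_var (c j p) $ j $ k $ l)"
proof -
  define B where "B i j = (\<Sum>k\<in>UNIV. \<Sum>l\<in>UNIV. objective c $ i $ j $ k $ l * x $ i $ j $ k $ l)"
    for i j
  have "inner (objective c) x = (\<Sum>i\<in>UNIV. \<Sum>j\<in>UNIV. B i j)"
    by (simp add: inner_vec_def B_def)
  also have "\<dots> = (\<Sum>j\<in>UNIV. \<Sum>i\<in>UNIV. B i j)"
    by (rule sum.swap)
  also have "\<dots> = (\<Sum>j\<in>UNIV. \<Sum>p\<in>UNIV. B (lit_var (c j p)) j)"
  proof (rule sum.cong[OF refl])
    fix j
    have "B i j = 0" if "i \<notin> range (\<lambda>p. lit_var (c j p))" for i
    proof -
      have "c j p \<noteq> Pos i" "c j p \<noteq> Neg i" for p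
        using that by (metis literal.sel rangeI)+
      then show ?thesis by (simp add: B_def objective_def)
    qed
    then have "(\<Sum>i\<in>UNIV. B i j) = (\<Sum>i\<in>range (\<lambda>p. lit_var (c j p)). B i j)"
      by (intro sum.mono_neutral_right) auto
    also have "\<dots> = (\<Sum>p\<in>UNIV. B (lit_var (c j p)) j)"
      using assms[of j] by (simp add: distinct_vars_def sum.reindex)
    finally show "(\<Sum>i\<in>UNIV. B i j) = (\<Sum>p\<in>UNIV. B (lit_var (c j p)) j)" .
  qed
  finally show ?thesis by (simp add: B_def)
qed

text \<open>Coefficients are 0 or 1, so each of the three blocks per clause contributes at most its
  total mass 1.\<close>

lemma inner_objective_le:
  fixes c :: "'n::finite \<Rightarrow> 'm::finite clause3"
  assumes c: "\<And>j. distinct_vars (c j)" and x: "x \<in> SATP_LP"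
  shows "inner (objective c) x \<le> 3 * real CARD('n)"
proof -
  have "(\<Sum>k\<in>UNIV. \<Sum>l\<in>UNIV. objective c $ i $ j $ k $ l * x $ i $ j $ k $ l)
      \<le> (\<Sum>k\<in>UNIV. \<Sum>l\<in>UNIV. x $ i $ j $ k $ l)" for i j
    using x by (intro sum_mono) (auto simp: objective_def SATP_LP_def)
  also have "(\<Sum>k\<in>UNIV. \<Sum>l\<in>UNIV. x $ i $ j $ k $ l) = 1" for i j
    using x by (simp add: SATP_LP_def)
  finally have "inner (objective c) x \<le> (\<Sum>j\<in>(UNIV::'n set). \<Sum>p\<in>(UNIV::3 set). 1)"
    unfolding inner_objective[of c, OF c] by (intro sum_mono)
  then show ?thesis by simp
qed

lemma inner_objective_vertex:
  fixes c :: "'n::finite \<Rightarrow> 'm::finite clause3"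
  assumes c: "\<And>j. distinct_vars (c j)"
  shows "inner (objective c) (satp_vertex \<tau> \<kappa>) = 3 * real CARD('n) -
    (\<Sum>j\<in>UNIV. of_bool (\<not> lit_true \<tau> (c j (\<kappa> j))) + of_bool (lit_true \<tau> (c j (\<kappa> j + 2))))"
proof -
  have block: "(\<Sum>k\<in>UNIV. \<Sum>l\<in>UNIV. y $ i $ j $ k $ l * satp_vertex \<tau> \<kappa> $ i $ j $ k $ l)
      = y $ i $ j $ \<kappa> j $ (if \<tau> i then 1 else 2)" for y :: "('m, 'n) satp_space" and i j
    using exhaust_3[of "\<kappa> j"] by (auto simp: satp_vertex_def sum_3 sum_2)
  \<comment> \<open>A 0 arises at \<open>p = k\<close> when that literal is false, and at
    \<open>p = k + 2\<close>, the solution of \<open>k = p + 1\<close> modulo 3, when that literal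
    is true. The two places differ, so the losses add up.\<close>
  have clause: "(\<Sum>p\<in>UNIV. if k = p \<and> \<not> t p \<or> k = p + 1 \<and> t p then 0 else (1::real))
      = 3 - (of_bool (\<not> t k) + of_bool (t (k + 2)))" for t and k :: 3
    using exhaust_3[of k] by (elim disjE) (simp_all add: sum_3 numerals_mod_3)
  have "inner (objective c) (satp_vertex \<tau> \<kappa>) =
    (\<Sum>j\<in>UNIV. 3 - (of_bool (\<not> lit_true \<tau> (c j (\<kappa> j))) + of_bool (lit_true \<tau> (c j (\<kappa> j + 2)))))"
    unfolding inner_objective[of c, OF c] block objective_at_literal[of c, OF c] clause ..
  then show ?thesis by (simp add: sum_subtractf)
qed

lemma inner_objective_vertex_eq_iff:
  fixes c :: "'n::finite \<Rightarrow> 'm::finite clause3"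
  assumes "\<And>j. distinct_vars (c j)"
  shows "inner (objective c) (satp_vertex \<tau> \<kappa>) = 3 * real CARD('n) \<longleftrightarrow>
    (\<forall>j. lit_true \<tau> (c j (\<kappa> j)) \<and> \<not> lit_true \<tau> (c j (\<kappa> j + 2)))"
  unfolding inner_objective_vertex[of c, OF assms] by (simp add: sum_nonneg_eq_0_iff add_nonneg_eq_0_iff)

text \<open>Modulo 3, \<open>k + 2\<close> is the predecessor of \<open>k\<close>. If every true
  place had a true predecessor, one true place would make all three true.\<close>

lemma cyclic_step_iff_nonconstant:
  fixes P :: "3 \<Rightarrow> bool"
  shows "(\<exists>k. P k \<and> \<not> P (k + 2)) \<longleftrightarrow> (\<exists>k. P k) \<and> (\<exists>k. \<not> P k)"
  by (auto simp: exists_3 numerals_mod_3)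

text \<open>A closed half-space is convex, so it contains the hull as soon as it contains the
  integral points, which are all vertices.\<close>

lemma SATP_linear_le:
  fixes y :: "('m::finite, 'n::finite) satp_space"
  assumes "\<And>\<tau> \<kappa>. inner y (satp_vertex \<tau> \<kappa>) \<le> b" and x: "x \<in> SATP"
  shows "inner y x \<le> b"
proof -
  have "SATP \<subseteq> {x. inner y x \<le> b}"
    unfolding SATP_def
    by (rule hull_minimal)
      (use assms(1) in \<open>auto simp: convex_halfspace_le elim!: integral_SATP_LP_is_vertex\<close>)
  then show ?thesis using x by auto
qed

text \<open>If every vertex had a smaller value than \<open>x\<close>, the convex open half-space
  below that value would contain the whole hull, and hence \<open>x\<close> itself.\<close>

lemma SATP_linear_attained_at_vertex:
  fixes y :: "('m::finite, 'n::finite) satp_space"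
  assumes x: "x \<in> SATP"
  obtains \<tau> \<kappa> where "inner y x \<le> inner y (satp_vertex \<tau> \<kappa>)"
proof (rule ccontr)
  assume "\<not> thesis"
  then have lt: "inner y (satp_vertex \<tau> \<kappa>) < inner y x" for \<tau> \<kappa>
    using that by (meson not_le)
  have "SATP \<subseteq> {z. inner y z < inner y x}"
    unfolding SATP_def
    by (rule hull_minimal)
      (use lt in \<open>auto simp: convex_halfspace_lt elim!: integral_SATP_LP_is_vertex\<close>)
  then show False using x by auto
qed

theorem theorem13:
  fixes c :: "'n::finite \<Rightarrow> 'm::finite clause3"
    and y :: "('m, 'n) satp_space"
    and f :: "('m, 'n) satp_space \<Rightarrow> real"
  assumes "\<And>j. distinct_vars (c j)"
    and "y = objective c"
    and "\<And>x. f x = inner y x"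
  shows "(\<exists>\<tau>. \<forall>j. (\<exists>k. lit_true \<tau> (c j k)) \<and> (\<exists>k. \<not> lit_true \<tau> (c j k)))
    \<longleftrightarrow> is_max_over f SATP_LP (3 * real CARD('n)) \<and> is_max_over f SATP (3 * real CARD('n))"
proof -
  let ?N = "3 * real CARD('n)"
  have f: "f x = inner (objective c) x" for x
    by (simp add: assms)
  have le: "f x \<le> ?N" if "x \<in> SATP_LP" for x
    unfolding f using assms(1) that by (rule inner_objective_le)
  have le_SATP: "f x \<le> ?N" if "x \<in> SATP" for x
    using SATP_linear_le[OF _ that] le[OF satp_vertex_in_SATP_LP] unfolding f by blast
  have vertex_iff: "f (satp_vertex \<tau> \<kappa>) = ?N \<longleftrightarrow>
      (\<forall>j. lit_true \<tau> (c j (\<kappa> j)) \<and> \<not> lit_true \<tau> (c j (\<kappa> j + 2)))" for \<tau> \<kappa>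
    unfolding f using assms(1) by (rule inner_objective_vertex_eq_iff)
  have "(\<exists>\<tau>. \<forall>j. (\<exists>k. lit_true \<tau> (c j k)) \<and> (\<exists>k. \<not> lit_true \<tau> (c j k)))
      \<longleftrightarrow> (\<exists>\<tau> \<kappa>. f (satp_vertex \<tau> \<kappa>) = ?N)"
    \<comment> \<open>The suitable places found clause by clause are collected into one function
      \<open>\<kappa>\<close> by choice.\<close>
    unfolding vertex_iff cyclic_step_iff_nonconstant[symmetric] by metis
  also have "\<dots> \<longleftrightarrow> is_max_over f SATP_LP ?N \<and> is_max_over f SATP ?N"
  proof
    assume "\<exists>\<tau> \<kappa>. f (satp_vertex \<tau> \<kappa>) = ?N"
    then show "is_max_over f SATP_LP ?N \<and> is_max_over f SATP ?N"
      unfolding is_max_over_def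
      using satp_vertex_in_SATP_LP satp_vertex_in_SATP le le_SATP by blast
  next
    assume "is_max_over f SATP_LP ?N \<and> is_max_over f SATP ?N"
    then obtain x where "x \<in> SATP" "f x = ?N"
      by (auto simp: is_max_over_def)
    \<comment> \<open>The maximizer \<open>x\<close> may be fractional, but some vertex does at
      least as well, and the upper bound over \<open>SATP_LP\<close> then forces equality.\<close>
    then obtain \<tau> \<kappa> where "?N \<le> f (satp_vertex \<tau> \<kappa>)"
      by (metis SATP_linear_attained_at_vertex f)
    with le[OF satp_vertex_in_SATP_LP] show "\<exists>\<tau> \<kappa>. f (satp_vertex \<tau> \<kappa>) = ?N"
      by (meson order_antisym)
  qed
  finally show ?thesis .
qed

end
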